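(* Let $a\in(-1,\infty)$ be a real number and consider the entire function $f:\mathbb{C}\to\mathbb{C}$, $f(z)=\exp(z)+a$. Then the escaping set $I(f)=\{z\in\mathbb{C}: f^n(z)\to\infty \text{ as } n\to\infty\}$ is a connected subset of the complex plane $\mathbb{C}$.
   Context: Here $f^n$ denotes the $n$-th iterate of $f$, and $f^n(z)\to\infty$ means $|f^n(z)|\to\infty$ as $n\to\infty$. Connectedness is with respect to the subspace topology inherited from $\mathbb{C}$ (the point $\infty$ is not included). *)

theory Defs
  imports "HOL-Analysis.Analysis"
begin

definition escaping_set :: "(complex \<Rightarrow> complex) \<Rightarrow> complex set" where
  "escaping_set f = {z. filterlim (\<lambda>n. norm ((f ^^ n) z)) at_top sequentially}"

end

theory Submission
  imports Defs "HOL-Complex_Analysis.Conformal_Mappings"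
begin

text \<open>Let \<open>f z = exp z + a\<close> and let \<open>\<phi>\<close> be a continuous two-valued function on the escaping set
  \<open>I\<close>. Since \<open>a > -1\<close>, the real axis lies in \<open>I\<close>, and hence so do all lines \<open>Im z = k\<pi>\<close>.
  The branch \<open>L w = Ln (w - a)\<close> of the inverse of \<open>f\<close> maps the upper half-plane into the strip
  \<open>0 < Im z < \<pi>\<close>; the connected curves \<open>L\<^sup>m (\<real> + i\<pi>)\<close> in \<open>I\<close> accumulate at both boundary lines of
  this strip, so \<open>\<phi>\<close> takes the same value on both. By translation and conjugation \<open>\<phi>\<close> is constant on
  the union of all lines \<open>Im z = k\<pi>\<close>. This already holds if \<open>\<phi>\<close> is only continuous off a slit
  \<open>(-\<infinity>, t]\<close>, and in that form it can be pulled back along all branches of the logarithm, showing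
  that \<open>\<phi>\<close> is constant on the set of points eventually mapped to the real axis. By expansion along
  escaping orbits, these points are dense in \<open>I\<close>.\<close>

text \<open>Convergence in the discrete space \<open>bool\<close> means being eventually constant;
  this transfers values of \<phi> along sequences to their limits.\<close>

lemma continuous_on_bool_eventually_eq:
  fixes \<phi> :: "'a::topological_space \<Rightarrow> bool"
  assumes "continuous_on S \<phi>" "p \<longlonglongrightarrow> x" "x \<in> S" "\<And>n. p n \<in> S"
  shows "eventually (\<lambda>n. \<phi> (p n) = \<phi> x) sequentially"
proof -
  have "(\<lambda>n. \<phi> (p n)) \<longlonglongrightarrow> \<phi> x"
    using assms by (intro continuous_on_tendsto_compose[OF assms(1,2)]) auto
  then show ?thesis
    by (simp add: tendsto_discrete)
qed

section \<open>Symmetries, real orbits and lines in the escaping set\<close>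

locale exp_map =
  fixes a :: real
  assumes a_gt: "a > -1"
begin

definition f :: "complex \<Rightarrow> complex" where
  "f = (\<lambda>z. exp z + complex_of_real a)"

definition F :: "real \<Rightarrow> real" where
  "F x = exp x + a"

definition L :: "complex \<Rightarrow> complex" where
  "L w = Ln (w - of_real a)"

abbreviation I :: "complex set" where
  "I \<equiv> escaping_set f"

lemma f_mem_escaping_iff: "f z \<in> I \<longleftrightarrow> z \<in> I"
proof -
  have "(f ^^ n) (f z) = (f ^^ Suc n) z" for n
    by (simp only: funpow_Suc_right o_def)
  then show ?thesis
    unfolding escaping_set_def mem_Collect_eq
    using filterlim_sequentially_Suc[of "\<lambda>n. norm ((f ^^ n) z)" at_top] by presburger
qed

lemma funpow_mem_escaping_iff: "(f ^^ n) z \<in> I \<longleftrightarrow> z \<in> I"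
  by (induction n) (simp_all add: f_mem_escaping_iff)

lemma f_add_period: "f (z + of_int (2 * k) * pi * \<i>) = f z"
proof -
  have "exp (z + of_int (2 * k) * pi * \<i>) = exp z"
    unfolding exp_eq by (intro exI[of _ k]) simp
  then show ?thesis by (simp add: f_def)
qed

lemma add_period_mem_escaping_iff: "z + of_int (2 * k) * pi * \<i> \<in> I \<longleftrightarrow> z \<in> I"
  using f_add_period f_mem_escaping_iff by metis

lemma cnj_mem_escaping_iff: "cnj z \<in> I \<longleftrightarrow> z \<in> I"
proof -
  have "(f ^^ n) (cnj z) = cnj ((f ^^ n) z)" for n
    by (induction n) (simp_all add: f_def exp_cnj)
  then show ?thesis
    by (simp add: escaping_set_def)
qed

lemma f_of_real: "f (of_real x) = of_real (F x)"
  by (simp add: f_def F_def exp_of_real)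

lemma funpow_f_of_real: "(f ^^ n) (of_real x) = of_real ((F ^^ n) x)"
  by (induction n) (simp_all add: f_of_real)

text \<open>By \<open>exp x \<ge> 1 + x\<close>, each step gains at least \<open>1 + a\<close>,
  which is positive, so real orbits escape.\<close>

lemma funpow_F_ge: "(F ^^ n) x \<ge> x + n * (1 + a)"
proof (induction n)
  case (Suc n)
  have "F ((F ^^ n) x) \<ge> (F ^^ n) x + (1 + a)"
    using exp_ge_add_one_self[of "(F ^^ n) x"] unfolding F_def by linarith
  then show ?case using Suc by (simp add: algebra_simps)
qed simp

lemma filterlim_funpow_F: "filterlim (\<lambda>n. (F ^^ n) x) at_top sequentially"
proof (rule filterlim_at_top_mono)
  show "filterlim (\<lambda>n. x + real n * (1 + a)) at_top sequentially"
    using a_gt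
    by (intro filterlim_tendsto_add_at_top[OF tendsto_const]
        filterlim_at_top_mult_tendsto_pos[OF tendsto_const] filterlim_real_sequentially) auto
qed (use funpow_F_ge in auto)

lemma of_real_mem_escaping: "of_real x \<in> I"
proof -
  have "filterlim (\<lambda>n. norm ((f ^^ n) (of_real x))) at_top sequentially"
    by (rule filterlim_at_top_mono[OF filterlim_funpow_F[of x] always_eventually])
      (simp add: funpow_f_of_real abs_ge_self)
  then show ?thesis by (simp add: escaping_set_def)
qed

lemma Im_f: "Im (f z) = exp (Re z) * sin (Im z)"
  by (simp add: f_def Im_exp)

lemma Im_f_eq_0_iff: "Im (f z) = 0 \<longleftrightarrow> (\<exists>k::int. Im z = k * pi)"
  by (simp add: Im_f sin_zero_iff_int2)

lemma Im_eq_0_mem_escaping: "Im z = 0 \<Longrightarrow> z \<in> I"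
  using of_real_mem_escaping[of "Re z"] complex_is_Real_iff of_real_Re by metis

lemma line_mem_escaping: "Im z = of_int k * pi \<Longrightarrow> z \<in> I"
  using Im_eq_0_mem_escaping Im_f_eq_0_iff f_mem_escaping_iff by blast

section \<open>The inverse branch \<open>L\<close>: iterates, continuity and contraction\<close>

lemma f_L: "w \<noteq> of_real a \<Longrightarrow> f (L w) = w"
  by (simp add: f_def L_def)

lemma Im_L: "Im w > 0 \<Longrightarrow> 0 < Im (L w) \<and> Im (L w) < pi"
  unfolding L_def by (rule Im_Ln_pos_lt_imp) simp

lemma L_of_real: "x > a \<Longrightarrow> L (of_real x) = of_real (ln (x - a))"
  unfolding L_def by (simp add: Ln_of_real flip: of_real_diff)

lemma L_of_real_F: "L (of_real (F x)) = of_real x"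
  by (subst L_of_real) (simp_all add: F_def)

lemma isCont_L: "Im w \<noteq> 0 \<or> Re w > a \<Longrightarrow> isCont L w"
  unfolding L_def by (intro continuous_intros) (auto simp: complex_nonpos_Reals_iff)

lemma funpow_L_upper:
  assumes "Im w > 0"
  shows "Im ((L ^^ m) w) > 0" "(f ^^ m) ((L ^^ m) w) = w"
proof -
  show *: "Im ((L ^^ m) w) > 0" for m
    by (induction m) (use assms Im_L in auto)
  show "(f ^^ m) ((L ^^ m) w) = w"
  proof (induction m)
    case (Suc m)
    have "(L ^^ m) w \<noteq> of_real a"
      using *[of m] by auto
    then show ?case
      using Suc unfolding funpow_Suc_right[of m f] by (simp add: f_L)
  qed simp
qed

lemma continuous_on_funpow_L: "continuous_on {w. Im w > 0} (L ^^ m)"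
proof (induction m)
  case (Suc m)
  have "isCont L z" if "z \<in> (L ^^ m) ` {w. Im w > 0}" for z
  proof -
    have "Im z > 0" using that funpow_L_upper(1) by blast
    then show ?thesis by (simp add: isCont_L)
  qed
  then have "continuous_on ((L ^^ m) ` {w. Im w > 0}) L"
    by (intro continuous_at_imp_continuous_on ballI)
  then show ?case
    using continuous_on_compose[OF Suc] by simp
qed (simp add: id_def)

lemma L_contraction:
  assumes "Re z \<ge> a + 2" "Re w \<ge> a + 2"
  shows "norm (L z - L w) \<le> 1 / 2 * norm (z - w)"
proof (rule field_differentiable_bound[of "{z. Re z \<ge> a + 2}"])
  show "convex {z. a + 2 \<le> Re z}"
    by (rule convex_halfspace_Re_ge)
  fix z assume z: "z \<in> {z. a + 2 \<le> Re z}"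
  then show "(L has_field_derivative inverse (z - of_real a)) (at z within {z. a + 2 \<le> Re z})"
    unfolding L_def by (auto intro!: derivative_eq_intros simp: complex_nonpos_Reals_iff)
  have "2 \<le> norm (z - of_real a)"
    using z complex_Re_le_cmod[of "z - of_real a"] by simp
  then show "norm (inverse (z - of_real a)) \<le> 1 / 2"
    using le_imp_inverse_le[of 2 "norm (z - of_real a)"] by (simp add: norm_inverse)
qed (use assms in auto)

text \<open>Since \<open>Re (L w) = ln (norm (w - of_real a))\<close>, each pullback inherits a
  lower bound on the real part from the orbit of \<open>x\<close>, so all steps stay in the
  half-plane where \<open>L\<close> halves distances.\<close>

lemma funpow_L_contraction:
  assumes "x \<ge> a + 2" "Re w \<ge> (F ^^ m) x"
  shows "norm ((L ^^ m) w - of_real x) \<le> (1 / 2) ^ m * norm (w - of_real ((F ^^ m) x))"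
  using assms(2)
proof (induction m arbitrary: w)
  case (Suc m)
  let ?y = "(F ^^ m) x"
  have ge: "(F ^^ n) x \<ge> a + 2" for n
  proof -
    have "n * (1 + a) \<ge> 0" using a_gt by simp
    then show ?thesis using funpow_F_ge[of x n] assms(1) by linarith
  qed
  have w: "Re w \<ge> F ?y" using Suc.prems by simp
  have w2: "Re w \<ge> a + 2" using ge[of "Suc m"] w by simp
  have "exp ?y \<le> norm (w - of_real a)"
    using w complex_Re_le_cmod[of "w - of_real a"] by (simp add: F_def)
  then have "?y \<le> ln (norm (w - of_real a))"
    by (subst ln_ge_iff) (auto intro: less_le_trans[OF exp_gt_zero])
  then have "?y \<le> Re (L w)"
    unfolding L_def using w2 by (subst Re_Ln) auto
  from Suc.IH[OF this]
  have "norm ((L ^^ Suc m) w - of_real x) \<le> (1 / 2) ^ m * norm (L w - L (of_real (F ?y)))"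
    by (simp add: funpow_Suc_right L_of_real_F del: funpow.simps)
  also have "\<dots> \<le> (1 / 2) ^ m * (1 / 2 * norm (w - of_real (F ?y)))"
    by (intro mult_left_mono L_contraction) (use w2 ge[of "Suc m"] in auto)
  finally show ?case by simp
qed simp

text \<open>Values of \<open>F\<close> exceed \<open>a\<close>, so they lie off the cut of
  \<open>L\<close>, and there \<open>L\<close> inverts \<open>F\<close>.\<close>

lemma funpow_L_tendsto:
  assumes "p \<longlonglongrightarrow> complex_of_real ((F ^^ j) v)"
  shows "(\<lambda>m. (L ^^ j) (p m)) \<longlonglongrightarrow> of_real v"
  using assms
proof (induction j arbitrary: v)
  case (Suc j)
  have "(\<lambda>m. (L ^^ j) (p m)) \<longlonglongrightarrow> of_real (F v)"
    using Suc.prems by (intro Suc.IH) (simp add: funpow_swap1)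
  moreover have "isCont L (of_real (F v))"
    by (rule isCont_L) (simp add: F_def)
  ultimately have "(\<lambda>m. L ((L ^^ j) (p m))) \<longlonglongrightarrow> L (of_real (F v))"
    using isCont_tendsto_compose by blast
  then show ?case by (simp add: L_of_real_F)
qed simp

section \<open>Two-valued functions on one strip\<close>

definition strip :: "real \<Rightarrow> complex set" where
  "strip t = {z \<in> I. 0 \<le> Im z \<and> Im z \<le> pi \<and> (Im z = 0 \<longrightarrow> Re z > t)}"

text \<open>The plane cut along the ray from \<open>-\<infinity>\<close> to \<open>t\<close>, that
  is, the complement of the slit. This shape survives pullback: the branches of the logarithm used
  below map \<open>slit (F t)\<close> into \<open>slit t\<close>.\<close>

definition slit :: "real \<Rightarrow> complex set" where
  "slit t = {z. Im z \<noteq> 0 \<or> Re z > t}"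

text \<open>In the proof, \<open>(L ^^ m) (w x m)\<close> converges to the real point \<open>x\<close> since \<open>L\<close> contracts far to the
  right. A point \<open>y\<close> of the line \<open>\<real> + i\<pi>\<close> is reached by pulling these points further back along
  the orbit of \<open>v = f y < a\<close>; the last step starts at the cut of \<open>L\<close>, where \<open>L\<close> is continuous only
  from above.\<close>

lemma strip_const:
  fixes \<phi> :: "complex \<Rightarrow> bool"
  assumes cont: "continuous_on (strip t) \<phi>"
  shows "\<exists>c. \<forall>z\<in>strip t. Im z = 0 \<or> Im z = pi \<longrightarrow> \<phi> z = c"
proof -
  define \<Gamma> where "\<Gamma> m = (L ^^ m) ` {w. Im w = pi}" for m
  have \<Gamma>_strip: "\<Gamma> m \<subseteq> strip t" for m
  proof -
    have "(L ^^ m) w \<in> strip t" if w: "Im w = pi" for w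
    proof -
      have pos: "Im w > 0" using w by simp
      have "w \<in> I" by (rule line_mem_escaping[of _ 1]) (use w in simp)
      then have "(L ^^ m) w \<in> I"
        using funpow_L_upper(2)[OF pos, of m] funpow_mem_escaping_iff[of m] by metis
      moreover have "Im ((L ^^ m) w) \<le> pi"
        by (cases m) (use w Im_L funpow_L_upper(1)[OF pos] in \<open>auto intro: less_imp_le\<close>)
      ultimately show ?thesis
        using funpow_L_upper(1)[OF pos, of m] by (simp add: strip_def)
    qed
    then show ?thesis by (auto simp: \<Gamma>_def)
  qed
  have \<Gamma>_const: "\<phi> z = \<phi> w" if "z \<in> \<Gamma> m" "w \<in> \<Gamma> m" for m z w
  proof -
    have "convex {w. Im w = pi}"
      using convex_hyperplane[of \<i> pi] by (simp add: inner_complex_def)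
    then have "connected (\<Gamma> m)"
      unfolding \<Gamma>_def
      by (intro connected_continuous_image continuous_on_subset[OF continuous_on_funpow_L]
          convex_connected) auto
    moreover have "continuous_on (\<Gamma> m) \<phi>"
      using cont \<Gamma>_strip continuous_on_subset by blast
    ultimately show ?thesis
      using that unfolding connected_iff_const by metis
  qed
  have real_strip: "of_real x \<in> strip t" if "x > t" for x
    using that of_real_mem_escaping by (simp add: strip_def)
  have real_const: "\<phi> (of_real x) = \<phi> (of_real y)" if "x > t" "y > t" for x y
  proof -
    have "connected (complex_of_real ` {t<..})"
      by (intro connected_continuous_image continuous_intros) simp
    moreover have "continuous_on (complex_of_real ` {t<..}) \<phi>"
      by (rule continuous_on_subset[OF cont]) (use real_strip in auto)
    ultimately show ?thesis
      using that unfolding connected_iff_const by (metis greaterThan_iff image_eqI)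
  qed
  \<comment> \<open>These points lie at height \<open>pi\<close> above the real orbit; for
    \<open>x \<ge> a + 2\<close>, pulling back \<open>m\<close> times brings them within
    \<open>pi / 2 ^ m\<close> of \<open>x\<close>.\<close>
  define w where "w x m = Complex ((F ^^ m) x) pi" for x m
  have w: "(L ^^ m) (w x n) \<in> \<Gamma> m" for x m n
    by (simp add: \<Gamma>_def w_def)
  have p_lim: "(\<lambda>m. (L ^^ m) (w x m)) \<longlonglongrightarrow> of_real x" if "x \<ge> a + 2" for x
  proof -
    have "norm ((L ^^ m) (w x m) - of_real x) \<le> (1 / 2) ^ m * pi" for m
    proof -
      have "w x m - of_real ((F ^^ m) x) = pi * \<i>"
        by (simp add: w_def complex_eq_iff)
      then show ?thesis
        using funpow_L_contraction[OF that, of m "w x m"] by (simp add: w_def norm_mult)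
    qed
    then have "eventually (\<lambda>m. norm ((L ^^ m) (w x m) - of_real x) \<le> (1 / 2) ^ m * pi) sequentially"
      by simp
    moreover have "(\<lambda>m. (1 / 2) ^ m * pi) \<longlonglongrightarrow> 0"
      by (intro tendsto_mult_left_zero LIMSEQ_power_zero) simp
    ultimately have "(\<lambda>m. (L ^^ m) (w x m) - of_real x) \<longlonglongrightarrow> 0"
      by (rule Lim_null_comparison)
    then show ?thesis by (simp add: LIM_zero_iff)
  qed
  have top: "\<phi> y = \<phi> (of_real (t + 1))" if y: "Im y = pi" "y \<in> strip t" for y
  proof -
    define v where "v = a - exp (Re y)"
    \<comment> \<open>Far along its orbit, \<open>v\<close> has moved to the right of the slit and
      into the half-plane where \<open>L\<close> contracts.\<close>
    have "eventually (\<lambda>j. (F ^^ j) v \<ge> max (t + 1) (a + 2)) sequentially"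
      using filterlim_funpow_F[of v] unfolding filterlim_at_top by blast
    then obtain j where j: "(F ^^ j) v \<ge> max (t + 1) (a + 2)"
      by (auto simp: eventually_sequentially)
    define x where "x = (F ^^ j) v"
    have x: "x > t" "x \<ge> a + 2" using j by (auto simp: x_def)
    define q where "q m = (L ^^ j) ((L ^^ m) (w x m))" for m
    have q_upper: "Im (q m) > 0" for m
      unfolding q_def by (intro funpow_L_upper(1)) (simp add: w_def)
    have q_lim: "q \<longlonglongrightarrow> of_real v"
      unfolding q_def using p_lim[OF x(2)] funpow_L_tendsto by (simp add: x_def)
    \<comment> \<open>Passing to \<open>a - q m\<close> takes the limit off the cut, because
      \<open>a - v = exp (Re y)\<close> is positive; the sign of \<open>Im (q m)\<close> selects the
      summand \<open>\<i> * pi\<close>.\<close>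
    have Lq: "L (q m) = Ln (of_real a - q m) + \<i> * pi" for m
    proof -
      have "Im (of_real a - q m) \<noteq> 0" using q_upper[of m] by simp
      then have "of_real a - q m \<noteq> 0" by force
      then show ?thesis
        using Ln_minus[of "of_real a - q m"] q_upper[of m] by (simp add: L_def)
    qed
    have "of_real a - complex_of_real v = of_real (exp (Re y))"
      by (simp add: v_def)
    moreover have "(\<lambda>m. Ln (of_real a - q m)) \<longlonglongrightarrow> Ln (of_real a - of_real v)"
      by (intro tendsto_Ln tendsto_intros q_lim) (simp add: v_def complex_nonpos_Reals_iff)
    ultimately have "(\<lambda>m. Ln (of_real a - q m) + \<i> * pi) \<longlonglongrightarrow> of_real (Re y) + \<i> * pi"
      by (intro tendsto_intros) (simp add: Ln_of_real)
    moreover have "of_real (Re y) + \<i> * pi = y"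
      using y(1) by (simp add: complex_eq_iff)
    ultimately have "(\<lambda>m. L (q m)) \<longlonglongrightarrow> y"
      by (simp only: Lq)
    moreover have Lq_\<Gamma>: "L (q m) \<in> \<Gamma> (Suc (j + m))" for m
      using w[of "Suc (j + m)" x m] by (simp add: q_def funpow_add)
    ultimately have "eventually (\<lambda>m. \<phi> (L (q m)) = \<phi> y) sequentially"
      using \<Gamma>_strip y(2) by (intro continuous_on_bool_eventually_eq[OF cont]) auto
    moreover have "eventually (\<lambda>m. \<phi> ((L ^^ m) (w x m)) = \<phi> (of_real x)) sequentially"
      by (rule continuous_on_bool_eventually_eq[OF cont p_lim[OF x(2)] real_strip[OF x(1)]])
        (use \<Gamma>_strip w in blast)
    \<comment> \<open>The shift by \<open>Suc j\<close> puts the \<open>m\<close>-th terms of both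
      sequences on the same curve \<open>\<Gamma> (Suc (j + m))\<close>.\<close>
    then have "eventually (\<lambda>m. \<phi> ((L ^^ (m + Suc j)) (w x (m + Suc j))) = \<phi> (of_real x)) sequentially"
      by (subst eventually_sequentially_seg)
    ultimately have "eventually (\<lambda>m. \<phi> y = \<phi> (of_real x)) sequentially"
    proof eventually_elim
      case (elim m)
      have "m + Suc j = Suc (j + m)" by simp
      then show ?case
        using elim \<Gamma>_const[OF Lq_\<Gamma>[of m] w[of "Suc (j + m)" x "Suc (j + m)"]] by metis
    qed
    then show ?thesis using real_const[of x "t + 1"] x by simp
  qed
  have bottom: "\<phi> y = \<phi> (of_real (t + 1))" if "Im y = 0" "y \<in> strip t" for y
  proof -
    have "y = of_real (Re y)" using that(1) by (simp add: complex_eq_iff)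
    then show ?thesis
      using real_const[of "Re y" "t + 1"] that by (simp add: strip_def)
  qed
  show ?thesis using top bottom by blast
qed

section \<open>Two-valued functions on all lines and their preimages\<close>

lemma lines_adjacent:
  fixes \<phi> :: "complex \<Rightarrow> bool" and k :: int
  assumes cont: "continuous_on (I \<inter> slit t) \<phi>"
    and z: "z \<in> slit t" "Im z = k * pi \<or> Im z = (k + 1) * pi"
    and w: "w \<in> slit t" "Im w = k * pi \<or> Im w = (k + 1) * pi"
  shows "\<phi> z = \<phi> w"
proof -
  \<comment> \<open>The real axis bounds the band only for \<open>k = 0\<close> and
    \<open>k = -1\<close>, where the slit must be respected; otherwise the cut-off only has to lie
    left of both points.\<close>
  define s where "s = (if k = 0 \<or> k = -1 then t else min (Re z) (Re w) - 1)"
  \<comment> \<open>\<open>h\<close> carries the base strip to the band between lines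
    \<open>k\<close> and \<open>k + 1\<close>, by a period translation for even \<open>k\<close> and
    by conjugation followed by one for odd \<open>k\<close>; \<open>g\<close> is its
    inverse.\<close>
  define h where "h u = (if even k then u + of_int k * pi * \<i> else cnj u + of_int (k + 1) * pi * \<i>)"
    for u
  define g where "g u = (if even k then u - of_int k * pi * \<i> else cnj u + of_int (k + 1) * pi * \<i>)"
    for u
  have hI: "h u \<in> I \<longleftrightarrow> u \<in> I" for u
  proof (cases "even k")
    case True
    then obtain j where "k = 2 * j" by blast
    then show ?thesis
      using add_period_mem_escaping_iff[of u j] by (simp add: h_def)
  next
    case False
    then obtain j where "k + 1 = 2 * j" by (metis even_plus_one_iff evenE)
    then show ?thesis
      using add_period_mem_escaping_iff[of "cnj u" j] False
      by (simp only: h_def if_False cnj_mem_escaping_iff)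
  qed
  have hg: "h (g x) = x" for x
    by (simp add: h_def g_def)
  have k: "k = 0 \<or> k = -1" if "0 \<le> y" "y \<le> pi" "k * pi + y = 0" for y
  proof -
    have "(k + 1) * pi \<ge> 0" "k * pi \<le> 0" using that by (auto simp: algebra_simps)
    then show ?thesis
      using pi_gt_zero unfolding zero_le_mult_iff mult_le_0_iff by linarith
  qed
  have h_slit: "h u \<in> I \<inter> slit t" if u: "u \<in> strip s" for u
  proof -
    have "Re u > t" if "Im (h u) = 0"
    proof -
      have "k = 0 \<or> k = -1"
      proof (cases "even k")
        case True
        with that u show ?thesis
          by (intro k[of "Im u"]) (auto simp: h_def strip_def)
      next
        case False
        with that u show ?thesis
          by (intro k[of "pi - Im u"]) (auto simp: h_def strip_def algebra_simps)
      qed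
      then show ?thesis
        using that u by (auto simp: h_def strip_def s_def)
    qed
    then show ?thesis
      using u hI by (auto simp: slit_def strip_def h_def)
  qed
  have cover: "g x \<in> strip s \<and> (Im (g x) = 0 \<or> Im (g x) = pi)"
    if x: "x \<in> slit t" "Im x = k * pi \<or> Im x = (k + 1) * pi"
      and s: "k = 0 \<or> k = -1 \<or> Re x > s" for x
  proof -
    have "x \<in> I" using x(2) line_mem_escaping[of x k] line_mem_escaping[of x "k + 1"] by auto
    then have "g x \<in> I" using hI hg by metis
    moreover have "Im (g x) = 0 \<or> Im (g x) = pi"
      using x(2) by (auto simp: g_def algebra_simps)
    moreover have "Re x > s" if "Im (g x) = 0"
      using s that x(1) by (auto simp: g_def slit_def s_def)
    moreover have "Re (g x) = Re x" by (simp add: g_def)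
    ultimately show ?thesis by (auto simp: strip_def)
  qed
  have "continuous_on (strip s) h"
    unfolding h_def by (cases "even k") (auto intro!: continuous_intros)
  then have "continuous_on (strip s) (\<phi> \<circ> h)"
    using h_slit by (intro continuous_on_compose continuous_on_subset[OF cont]) auto
  then obtain c where "\<forall>u\<in>strip s. Im u = 0 \<or> Im u = pi \<longrightarrow> (\<phi> \<circ> h) u = c"
    using strip_const by blast
  then have c: "\<phi> x = c" if "x \<in> slit t" "Im x = k * pi \<or> Im x = (k + 1) * pi"
    "k = 0 \<or> k = -1 \<or> Re x > s" for x
    using cover[OF that] hg[of x] by (metis comp_apply)
  have "k = 0 \<or> k = -1 \<or> Re z > s \<and> Re w > s"
    by (auto simp: s_def)
  then show ?thesis
    using c[of z] c[of w] z w by blast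
qed

text \<open>Induction runs in both directions from the real axis, passing through the points with
  real part \<open>t + 1\<close> on successive lines.\<close>

lemma lines_const:
  fixes \<phi> :: "complex \<Rightarrow> bool" and k :: int
  assumes cont: "continuous_on (I \<inter> slit t) \<phi>" and "z \<in> slit t" "Im z = k * pi"
  shows "\<phi> z = \<phi> (of_real (t + 1))"
  using assms(2,3)
proof (induction k arbitrary: z rule: int_induct[of _ 0])
  case base
  then show ?case
    by (intro lines_adjacent[OF cont, of _ 0]) (auto simp: slit_def)
next
  case (step1 i)
  have "Complex (t + 1) (i * pi) \<in> slit t" by (simp add: slit_def)
  then show ?case
    using step1 lines_adjacent[OF cont, of z i "Complex (t + 1) (i * pi)"] by simp
next
  case (step2 i)
  have "Complex (t + 1) (i * pi) \<in> slit t" by (simp add: slit_def)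
  then show ?case
    using step2 lines_adjacent[OF cont, of z "i - 1" "Complex (t + 1) (i * pi)"] by simp
qed

text \<open>Pulling \<open>\<phi>\<close> back along a branch \<open>h\<close> of the logarithm reduces the exponent by one.\<close>

lemma preimages_const:
  fixes \<phi> :: "complex \<Rightarrow> bool"
  assumes "t \<ge> a" "continuous_on (I \<inter> slit t) \<phi>" "z \<in> slit t" "Im ((f ^^ n) z) = 0"
  shows "\<phi> z = \<phi> (of_real (t + 1))"
  using assms
proof (induction n arbitrary: t \<phi> z)
  case 0
  then show ?case using lines_const[of t \<phi> z 0] by simp
next
  case (Suc n)
  show ?case
  \<comment> \<open>A real \<open>f z\<close> may lie outside \<open>slit (F t)\<close>, but then
    \<open>z\<close> itself is on one of the lines.\<close>
  proof (cases "Im (f z) = 0")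
    case True
    then show ?thesis
      using lines_const Suc.prems Im_f_eq_0_iff by blast
  next
    case False
    have "exp (L (f z)) = exp z"
      by (simp add: L_def f_def)
    then obtain k :: int where k: "z = L (f z) + of_int (2 * k) * pi * \<i>"
      using exp_eq by metis
    \<comment> \<open>\<open>k\<close> selects the branch that sends \<open>f z\<close> back to
      \<open>z\<close>.\<close>
    define h where "h w = L w + of_int (2 * k) * pi * \<i>" for w
    have F_gt: "F t > a" by (simp add: F_def)
    have not_a: "w \<noteq> of_real a" if "w \<in> slit (F t)" for w
      using that F_gt by (auto simp: slit_def)
    have f_h: "f (h w) = w" if "w \<in> slit (F t)" for w
      unfolding h_def f_add_period using not_a[OF that] by (rule f_L)
    have h_real: "h (of_real x) = of_real (ln (x - a)) + of_int (2 * k) * pi * \<i>" "ln (x - a) > t"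
      if "x > F t" for x
    proof -
      have "exp t < x - a" using that by (simp add: F_def)
      then show "ln (x - a) > t" by (metis exp_gt_zero ln_exp ln_less_cancel_iff less_trans)
      show "h (of_real x) = of_real (ln (x - a)) + of_int (2 * k) * pi * \<i>"
        using that F_gt by (simp add: h_def L_of_real)
    qed
    have h_slit: "h w \<in> I \<inter> slit t" if w: "w \<in> I \<inter> slit (F t)" for w
    proof -
      have "h w \<in> I" using w f_h f_mem_escaping_iff by (metis IntE)
      moreover have "h w \<in> slit t"
      proof (cases "Im w = 0")
        case True
        then have "w = of_real (Re w)" "Re w > F t"
          using w by (auto simp: complex_eq_iff slit_def)
        then show ?thesis
          using h_real[of "Re w"] by (auto simp: slit_def)
      next
        case False
        then have "Im (f (h w)) \<noteq> 0" using w f_h by auto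
        then have "Im (h w) \<noteq> 0" by (auto simp: Im_f)
        then show ?thesis by (simp add: slit_def)
      qed
      ultimately show ?thesis by simp
    qed
    have "continuous_on (I \<inter> slit (F t)) h"
      unfolding h_def
      by (intro continuous_intros continuous_at_imp_continuous_on ballI isCont_L)
        (use F_gt in \<open>auto simp: slit_def\<close>)
    then have "continuous_on (I \<inter> slit (F t)) (\<phi> \<circ> h)"
      using h_slit by (intro continuous_on_compose continuous_on_subset[OF Suc.prems(2)]) auto
    moreover have "F t \<ge> a" "f z \<in> slit (F t)" "Im ((f ^^ n) (f z)) = 0"
      using F_gt False Suc.prems(4) by (auto simp: slit_def funpow_swap1)
    ultimately have "(\<phi> \<circ> h) (f z) = (\<phi> \<circ> h) (of_real (F t + 1))"
      by (intro Suc.IH)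
    then have "\<phi> z = \<phi> (h (of_real (F t + 1)))"
      using k by (simp add: h_def)
    \<comment> \<open>The point \<open>h (of_real (F t + 1))\<close> is on line
      \<open>2 * k\<close>, hence linked to the real axis.\<close>
    also have "\<dots> = \<phi> (of_real (t + 1))"
      by (rule lines_const[OF Suc.prems(2), of _ "2 * k"])
        (use h_real[of "F t + 1"] in \<open>auto simp: slit_def\<close>)
    finally show ?thesis .
  qed
qed

section \<open>Expansion along escaping orbits and density of preimages\<close>

lemma has_field_derivative_funpow_f:
  "(f ^^ n has_field_derivative (\<Prod>k<n. exp ((f ^^ k) z))) (at z)"
proof (induction n)
  case (Suc n)
  have "(f has_field_derivative exp ((f ^^ n) z)) (at ((f ^^ n) z))"
    unfolding f_def by (auto intro!: derivative_eq_intros)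
  then show ?case
    using DERIV_chain[OF _ Suc] by (simp add: mult.commute o_def)
qed (simp add: id_def)

text \<open>The factor \<open>exp ((f ^^ n) z)\<close> equals the next orbit point minus
  \<open>a\<close>, so eventually its modulus is at least 2 and the nonzero product grows
  geometrically.\<close>

lemma norm_deriv_funpow_f_unbounded:
  assumes "z \<in> I"
  shows "\<exists>n. norm (deriv (f ^^ n) z) \<ge> B"
proof -
  define D where "D n = norm (deriv (f ^^ n) z)" for n
  have D: "D n = (\<Prod>k<n. norm (exp ((f ^^ k) z)))" for n
    unfolding D_def using has_field_derivative_funpow_f[of n z, THEN DERIV_imp_deriv]
    by (simp only: prod_norm)
  have "eventually (\<lambda>n. norm ((f ^^ n) z) \<ge> 2 + \<bar>a\<bar>) sequentially"
    using assms by (simp add: escaping_set_def filterlim_at_top)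
  then obtain N where N: "norm ((f ^^ n) z) \<ge> 2 + \<bar>a\<bar>" if "n \<ge> N" for n
    by (auto simp: eventually_sequentially)
  have step: "D (Suc n) \<ge> D n * 2" if "n \<ge> N" for n
  proof -
    have "exp ((f ^^ n) z) = (f ^^ Suc n) z - of_real a"
      by (simp add: f_def)
    then have "norm (exp ((f ^^ n) z)) \<ge> 2"
      using N[of "Suc n"] that norm_triangle_ineq2[of "(f ^^ Suc n) z" "of_real a"] by simp
    then show ?thesis
      unfolding D prod.lessThan_Suc by (intro mult_left_mono prod_nonneg) auto
  qed
  have ge: "D (N + m) \<ge> D N * 2 ^ m" for m
  proof (induction m)
    case (Suc m)
    then show ?case using step[of "N + m"] by simp
  qed simp
  have "D N > 0" unfolding D by (intro prod_pos) auto
  moreover obtain m where "B / D N < 2 ^ m"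
    using real_arch_pow[of 2 "B / D N"] by auto
  ultimately have "B \<le> D N * 2 ^ m" by (simp add: field_simps)
  then show ?thesis using ge[of m] unfolding D_def by (intro exI[of _ "N + m"]) linarith
qed

text \<open>The derivatives of the iterates blow up at \<open>z\<close>, so by Bloch's theorem some iterate maps the
  ball onto a set containing a disc large enough to meet one of the lines \<open>Im = k\<pi>\<close>.\<close>

lemma preimages_dense:
  assumes "z \<in> I" "r > 0"
  shows "\<exists>x\<in>ball z r. \<exists>n. Im ((f ^^ n) x) = 0"
proof -
  \<comment> \<open>The 12 comes from Bloch's theorem; the radius 4 exceeds the spacing
    \<open>pi\<close> of the lines.\<close>
  obtain n where n: "norm (deriv (f ^^ n) z) \<ge> 12 * 4 / r"
    using norm_deriv_funpow_f_unbounded[OF assms(1)] by blast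
  have "(f ^^ n) holomorphic_on ball z r"
    using has_field_derivative_funpow_f
    by (auto simp: holomorphic_on_open)
  moreover have "4 \<le> r * norm (deriv (f ^^ n) z) / 12"
    using n assms(2) by (simp add: field_simps)
  ultimately obtain b where b: "ball b 4 \<subseteq> (f ^^ n) ` ball z r"
    using Bloch_general[of "f ^^ n" "ball z r" z r 4] assms(2)
    by (auto simp: frontier_ball)
  define k where "k = \<lfloor>Im b / pi\<rfloor>"
  have "k \<le> Im b / pi" "Im b / pi < k + 1"
    by (auto simp: k_def)
  then have "\<bar>k * pi - Im b\<bar> < 4"
    using pi_less_4 by (simp add: field_simps abs_if)
  moreover have "dist b (Complex (Re b) (k * pi)) = \<bar>k * pi - Im b\<bar>"
    by (simp add: dist_norm cmod_def)
  ultimately have "Complex (Re b) (k * pi) \<in> ball b 4" by simp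
  then obtain x where "x \<in> ball z r" "Complex (Re b) (k * pi) = (f ^^ n) x"
    using b by blast
  \<comment> \<open>One further iterate sends the line to the real axis.\<close>
  then have "Im ((f ^^ Suc n) x) = 0"
    using Im_f_eq_0_iff[of "(f ^^ n) x"] by (metis complex.sel(2) funpow.simps(2) comp_apply)
  then show ?thesis using \<open>x \<in> ball z r\<close> by blast
qed

section \<open>Connectedness from constancy on a dense subset\<close>

lemma connected_escaping_set: "connected I"
proof (rule connectedI_const)
  fix P :: "complex \<Rightarrow> bool"
  assume P: "continuous_on I P"
  have P_slit: "continuous_on (I \<inter> slit t) P" for t
    using P by (rule continuous_on_subset) simp
  have P_eq: "P z = P (of_real (a + 1))" if z: "Im ((f ^^ n) z) = 0" for z n
  proof (cases "z \<in> slit a")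
    case True
    then show ?thesis using preimages_const[OF _ P_slit] z by blast
  next
    case False
    \<comment> \<open>Such a point lies on the slit; moving the tip to \<open>Re z - 1\<close> frees
      both \<open>z\<close> and \<open>a + 1\<close>.\<close>
    then have "Im z = 0" "Re z \<le> a" by (auto simp: slit_def)
    then have "P z = P (of_real (Re z - 1 + 1))"
      by (intro lines_const[OF P_slit, of _ _ 0]) (auto simp: slit_def)
    also have "\<dots> = P (of_real (a + 1))"
      using \<open>Re z \<le> a\<close> by (intro lines_const[OF P_slit, of _ _ 0, symmetric]) (auto simp: slit_def)
    finally show ?thesis .
  qed
  have "P z = P (of_real (a + 1))" if z: "z \<in> I" for z
  proof -
    have "\<exists>x. dist z x < inverse (Suc m) \<and> (\<exists>n. Im ((f ^^ n) x) = 0)" for m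
      using preimages_dense[OF z, of "inverse (Suc m)"] by (auto simp: mem_ball)
    then obtain x where x: "\<And>m. dist z (x m) < inverse (Suc m)" "\<And>m. \<exists>n. Im ((f ^^ n) (x m)) = 0"
      by metis
    have "(\<lambda>m. dist (x m) z) \<longlonglongrightarrow> 0"
      by (rule Lim_null_comparison[OF always_eventually LIMSEQ_inverse_real_of_nat])
        (use x(1) in \<open>auto simp: dist_commute intro: less_imp_le\<close>)
    then have "x \<longlonglongrightarrow> z"
      by (rule tendsto_dist_iff[THEN iffD2])
    moreover have "x m \<in> I" for m
    proof -
      obtain n where "Im ((f ^^ n) (x m)) = 0" using x(2) by blast
      then show ?thesis using Im_eq_0_mem_escaping funpow_mem_escaping_iff[of n "x m"] by simp
    qed
    ultimately have "eventually (\<lambda>m. P (x m) = P z) sequentially"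
      using z by (intro continuous_on_bool_eventually_eq[OF P]) auto
    then obtain m where "P (x m) = P z"
      by (auto simp: eventually_sequentially)
    moreover obtain n where "Im ((f ^^ n) (x m)) = 0" using x(2) by blast
    ultimately show ?thesis using P_eq[of n "x m"] by simp
  qed
  then show "\<exists>c. \<forall>s\<in>I. P s = c" by blast
qed

end

theorem theorem1p1:
  fixes a :: real
  assumes "a > -1"
  shows "connected (escaping_set (\<lambda>z. exp z + complex_of_real a))"
proof -
  interpret exp_map a by unfold_locales (rule assms)
  show ?thesis
    using connected_escaping_set by (simp add: f_def)
qed

end
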